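(* For every $\alpha \in (0, \omega_1)$, there exists a map $\Psi_\alpha \colon D_\alpha^\omega \to L_1[0,1]$ such that, for every $x, y \in D_\alpha^\omega$: \[ \frac12 d_\alpha(x,y) \leq \|\Psi_\alpha(x) - \Psi_\alpha(y)\|_1 \leq d_\alpha(x,y). \]
   Context: $\omega=\{0,1,2,\dots\}$, $\omega_1$ is the first uncountable ordinal. For every limit ordinal $\alpha<\omega_1$ fix once and for all an enumeration $(\beta_n)_{n\in\omega}$ of all ordinals less than $\alpha$. **Countably branching diamonds.** Metric spaces $(D_\alpha^\omega,d_\alpha)$ with distinguished points $t_\alpha$ (top), $b_\alpha$ (bottom), satisfying $d_\alpha(t_\alpha,b_\alpha)=1$, are defined inductively. $D_0^\omega=\{t_0,b_0\}$ with $d_0(t_0,b_0)=1$. $D_1^\omega=\{t_1,b_1\}\cup\{x_1^i:i\in\omega\}$ with the complete bipartite graph structure between $\{t_1,b_1\}$ and $\{x_1^i:i\in\omega\}$, and $d_1$ is $\frac12$ times the shortest path metric. $D_{\alpha+1}^\omega$ is obtained from $D_1^\omega$ (with points now denoted $t_{\alpha+1},b_{\alpha+1},x_{\alpha+1}^i$) by replacing each edge $\{t_1,x_1^i\}$ by a copy of $D_\alpha^\omega$ whose top is $t_{\alpha+1}$ and whose bottom is $x^i_{\alpha+1}$, and each edge $\{x_1^i,b_1\}$ by a copy of $D_\alpha^\omega$ whose top is $x_{\alpha+1}^i$ and whose bottom is $b_{\alpha+1}$; each copy carries the metric $\frac12 d_\alpha$ and $d_{\alpha+1}$ is the resulting shortest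 path metric. For $\alpha$ limit, $D_\alpha^\omega$ is the disjoint union of the $D_{\beta_n}^\omega$, $n\in\omega$, in which all tops $t_{\beta_n}$ are identified to $t_\alpha$ and all bottoms $b_{\beta_n}$ to $b_\alpha$; $d_\alpha$ equals $d_{\beta_n}$ on each $D_{\beta_n}^\omega$ and is extended as the shortest path metric. *)

theory Defs
  imports "HOL-Analysis.Analysis" "HOL-Library.Countable_Set_Type"
begin

section \<open>The ordinals below \<open>\<omega>\<^sub>1\<close>\<close>

text \<open>
  The canonical cardinal successor of \<open>\<aleph>\<^sub>0\<close> is a well-order of type \<open>\<omega>\<^sub>1\<close>; its elements serve as
  the countable ordinals. The lemmas \<open>countable_below\<close> and \<open>uncountable_ordinals\<close> below
  characterise this order type.
\<close>

unbundle cardinal_syntax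

typedef countable_ordinal = "Field (cardSuc natLeq)"
proof -
  have "cardSuc natLeq \<noteq> {}"
  proof
    assume e: "cardSuc natLeq = {}"
    have "natLeq <o cardSuc natLeq" by (rule cardSuc_greater[OF natLeq_Card_order])
    hence "|Field natLeq| <o |Field (cardSuc natLeq)|"
      using natLeq_Card_order cardSuc_Card_order[OF natLeq_Card_order]
      by (meson card_of_Field_ordIso ordIso_ordLess_trans ordIso_symmetric ordLess_ordIso_trans)
    thus False using e by (metis Field_empty card_of_empty not_ordLess_ordLeq)
  qed
  thus ?thesis by (auto simp: Field_def)
qed

lemma Well_order_cardSuc_natLeq: "Well_order (cardSuc natLeq)"
  by (rule cardSuc_Well_order[OF natLeq_Card_order])

instantiation countable_ordinal :: wellorder
begin

definition less_eq_countable_ordinal :: "countable_ordinal \<Rightarrow> countable_ordinal \<Rightarrow> bool" where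
  "\<alpha> \<le> \<beta> \<longleftrightarrow> (Rep_countable_ordinal \<alpha>, Rep_countable_ordinal \<beta>) \<in> cardSuc natLeq"

definition less_countable_ordinal :: "countable_ordinal \<Rightarrow> countable_ordinal \<Rightarrow> bool" where
  "\<alpha> < \<beta> \<longleftrightarrow> \<alpha> \<le> \<beta> \<and> \<alpha> \<noteq> (\<beta> :: countable_ordinal)"

instance
proof -
  let ?r = "cardSuc natLeq"
  have W: "Well_order ?r" by (rule Well_order_cardSuc_natLeq)
  have refl: "refl_on (Field ?r) ?r" and tr: "trans ?r" and as: "antisym ?r"
    and tot: "total_on (Field ?r) ?r" and wf: "wf (?r - Id)"
    using W unfolding well_order_on_def linear_order_on_def partial_order_on_def preorder_on_def
    by auto
  note R = Rep_countable_ordinal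
  have le_refl: "\<alpha> \<le> \<alpha>" for \<alpha> :: countable_ordinal
    using refl R unfolding less_eq_countable_ordinal_def refl_on_def by auto
  have le_antisym: "\<alpha> \<le> \<beta> \<Longrightarrow> \<beta> \<le> \<alpha> \<Longrightarrow> \<alpha> = \<beta>" for \<alpha> \<beta> :: countable_ordinal
    using as unfolding less_eq_countable_ordinal_def
    by (metis antisymD Rep_countable_ordinal_inject)
  have le_trans: "\<alpha> \<le> \<beta> \<Longrightarrow> \<beta> \<le> \<gamma> \<Longrightarrow> \<alpha> \<le> \<gamma>" for \<alpha> \<beta> \<gamma> :: countable_ordinal
    using tr unfolding less_eq_countable_ordinal_def trans_def by blast
  have le_total: "\<alpha> \<le> \<beta> \<or> \<beta> \<le> \<alpha>" for \<alpha> \<beta> :: countable_ordinal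
    using tot R le_refl unfolding less_eq_countable_ordinal_def total_on_def
    by (metis Rep_countable_ordinal_inject)
  have wf': "wf (inv_image (?r - Id) Rep_countable_ordinal)"
    using wf by (rule wf_inv_image)
  have lt: "(\<beta>, \<alpha>) \<in> inv_image (?r - Id) Rep_countable_ordinal \<longleftrightarrow> \<beta> < \<alpha>" for \<alpha> \<beta>
    unfolding less_countable_ordinal_def less_eq_countable_ordinal_def inv_image_def
    by (auto simp: Rep_countable_ordinal_inject)
  show "OFCLASS(countable_ordinal, wellorder_class)"
  proof
    fix \<alpha> \<beta> \<gamma> :: countable_ordinal
    show "\<alpha> < \<beta> \<longleftrightarrow> \<alpha> \<le> \<beta> \<and> \<not> \<beta> \<le> \<alpha>"
      unfolding less_countable_ordinal_def using le_antisym le_refl by blast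
    show "\<alpha> \<le> \<alpha>" by (rule le_refl)
    show "\<alpha> \<le> \<beta> \<Longrightarrow> \<beta> \<le> \<gamma> \<Longrightarrow> \<alpha> \<le> \<gamma>" by (rule le_trans)
    show "\<alpha> \<le> \<beta> \<Longrightarrow> \<beta> \<le> \<alpha> \<Longrightarrow> \<alpha> = \<beta>" by (rule le_antisym)
    show "\<alpha> \<le> \<beta> \<or> \<beta> \<le> \<alpha>" by (rule le_total)
  next
    fix P :: "countable_ordinal \<Rightarrow> bool" and \<alpha>
    assume "\<And>\<alpha>. (\<And>\<beta>. \<beta> < \<alpha> \<Longrightarrow> P \<beta>) \<Longrightarrow> P \<alpha>"
    thus "P \<alpha>" using wf_induct_rule[OF wf', of P \<alpha>] unfolding lt by blast
  qed
qed

end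

lemma countable_below: "countable {..<\<alpha>}" for \<alpha> :: countable_ordinal
proof -
  let ?r = "cardSuc natLeq"
  have "|underS ?r (Rep_countable_ordinal \<alpha>)| <o ?r"
    using Rep_countable_ordinal by (intro card_of_underS cardSuc_Card_order natLeq_Card_order) auto
  hence "|underS ?r (Rep_countable_ordinal \<alpha>)| \<le>o natLeq"
    using cardSuc_ordLeq_ordLess[OF natLeq_Card_order card_of_Card_order] by blast
  hence "countable (underS ?r (Rep_countable_ordinal \<alpha>))"
    by (simp add: countable_card_le_natLeq)
  moreover have "Rep_countable_ordinal ` {..<\<alpha>} \<subseteq> underS ?r (Rep_countable_ordinal \<alpha>)"
    by (auto simp: underS_def less_countable_ordinal_def less_eq_countable_ordinal_def
        Rep_countable_ordinal_inject)
  ultimately have "countable (Rep_countable_ordinal ` {..<\<alpha>})" by (rule countable_subset[rotated])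
  thus ?thesis
    by (rule countable_image_inj_on) (auto simp: inj_on_def Rep_countable_ordinal_inject)
qed

lemma uncountable_ordinals: "uncountable (UNIV :: countable_ordinal set)"
proof
  assume "countable (UNIV :: countable_ordinal set)"
  hence "countable (range Rep_countable_ordinal)" by simp
  moreover have "range Rep_countable_ordinal = Field (cardSuc natLeq)"
    by (simp add: type_definition.Rep_range[OF type_definition_countable_ordinal])
  ultimately have "|Field (cardSuc natLeq)| \<le>o natLeq" by (simp add: countable_card_le_natLeq)
  moreover have "natLeq <o |Field (cardSuc natLeq)|"
    by (meson cardSuc_Card_order cardSuc_greater card_of_Field_ordIso natLeq_Card_order
        ordIso_symmetric ordLess_ordIso_trans)
  ultimately show False using not_ordLess_ordLeq by blast
qed

unbundle no cardinal_syntax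

lemma ex_greater_ordinal: "\<exists>\<beta>. \<alpha> < \<beta>" for \<alpha> :: countable_ordinal
proof (rule ccontr)
  assume "\<not> (\<exists>\<beta>. \<alpha> < \<beta>)"
  hence "UNIV = insert \<alpha> {..<\<alpha>}" by (auto simp: not_less order.order_iff_strict)
  thus False using countable_below[of \<alpha>] uncountable_ordinals by (metis countable_insert)
qed

instantiation countable_ordinal :: zero
begin

definition zero_countable_ordinal :: countable_ordinal where
  "0 = (LEAST \<alpha> :: countable_ordinal. True)"

instance ..

end

lemma zero_le_ordinal: "0 \<le> \<alpha>" for \<alpha> :: countable_ordinal
  unfolding zero_countable_ordinal_def by (rule Least_le) simp

definition ord_suc :: "countable_ordinal \<Rightarrow> countable_ordinal" where
  "ord_suc \<alpha> = (LEAST \<beta>. \<alpha> < \<beta>)"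

definition is_limit :: "countable_ordinal \<Rightarrow> bool" where
  "is_limit \<alpha> \<longleftrightarrow> \<alpha> \<noteq> 0 \<and> (\<forall>\<beta>. \<alpha> \<noteq> ord_suc \<beta>)"

definition ord_pred :: "countable_ordinal \<Rightarrow> countable_ordinal" where
  "ord_pred \<alpha> = (THE \<beta>. \<alpha> = ord_suc \<beta>)"

lemma less_ord_suc: "\<alpha> < ord_suc \<alpha>"
  unfolding ord_suc_def using ex_greater_ordinal[of \<alpha>] by (rule LeastI_ex)

lemma ord_suc_least: "\<alpha> < \<beta> \<Longrightarrow> ord_suc \<alpha> \<le> \<beta>"
  unfolding ord_suc_def by (rule Least_le)

lemma ord_suc_inject [simp]: "ord_suc \<alpha> = ord_suc \<beta> \<longleftrightarrow> \<alpha> = \<beta>"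
  by (metis less_ord_suc linorder_less_linear not_less ord_suc_least)

lemma ord_suc_nonzero [simp]: "ord_suc \<alpha> \<noteq> 0"
  using less_ord_suc[of \<alpha>] zero_le_ordinal[of \<alpha>] by auto

lemma ord_pred_suc [simp]: "ord_pred (ord_suc \<alpha>) = \<alpha>"
  unfolding ord_pred_def by auto

lemma not_is_limit_suc [simp]: "\<not> is_limit (ord_suc \<alpha>)" "\<not> is_limit 0"
  unfolding is_limit_def by auto

lemma ordinal_cases:
  obtains (zero) "\<alpha> = 0" | (suc) \<beta> where "\<alpha> = ord_suc \<beta>" | (limit) "is_limit \<alpha>"
  unfolding is_limit_def by blast


section \<open>Shortest path metrics\<close>

text \<open>
  A weighted link relation \<open>L x y r\<close> means that one can pass from \<open>x\<close> to \<open>y\<close> directly, at cost \<open>r\<close>.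
\<close>

inductive chain :: "('p \<Rightarrow> 'p \<Rightarrow> real \<Rightarrow> bool) \<Rightarrow> 'p \<Rightarrow> 'p \<Rightarrow> real \<Rightarrow> bool"
  for L where
    chain_refl: "chain L x x 0"
  | chain_step: "L x y r \<Longrightarrow> chain L y z s \<Longrightarrow> chain L x z (r + s)"

definition path_dist :: "('p \<Rightarrow> 'p \<Rightarrow> real \<Rightarrow> bool) \<Rightarrow> 'p \<Rightarrow> 'p \<Rightarrow> real" where
  "path_dist L x y = Inf {r. chain L x y r}"


section \<open>Countably branching diamonds\<close>

text \<open>
  Points of all diamonds live in one type. \<open>Top\<close> and \<open>Bot\<close> are $t_\alpha$ and $b_\alpha$, and
  \<open>Mid i\<close> is $x^i_\alpha$. The remaining constructors tag the interior points (those other than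
  top and bottom) of a glued copy: \<open>Upper i p\<close> and \<open>Lower i p\<close> for the copies replacing the edges
  $\{t,x^i\}$ and $\{x^i,b\}$, and \<open>Part n p\<close> for the copy of $D_{\beta_n}$ in a limit diamond.
  The maps \<open>upper\<close>, \<open>lower\<close>, \<open>part\<close> embed a copy, performing the identifications of its
  top and bottom.
\<close>

datatype point =
  Top | Bot | Mid nat | Upper nat point | Lower nat point | Part nat point

definition upper :: "nat \<Rightarrow> point \<Rightarrow> point" where
  "upper i p = (if p = Top then Top else if p = Bot then Mid i else Upper i p)"

definition lower :: "nat \<Rightarrow> point \<Rightarrow> point" where
  "lower i p = (if p = Top then Mid i else if p = Bot then Bot else Lower i p)"

definition part :: "nat \<Rightarrow> point \<Rightarrow> point" where
  "part n p = (if p = Top then Top else if p = Bot then Bot else Part n p)"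

type_synonym diamond_space = "point set \<times> (point \<Rightarrow> point \<Rightarrow> real)"

definition zero_diamond :: diamond_space where
  "zero_diamond = ({Top, Bot}, \<lambda>x y. if x = y then 0 else 1)"

inductive suc_link :: "diamond_space \<Rightarrow> point \<Rightarrow> point \<Rightarrow> real \<Rightarrow> bool" for D where
  "p \<in> fst D \<Longrightarrow> q \<in> fst D \<Longrightarrow> suc_link D (upper i p) (upper i q) (1/2 * snd D p q)"
| "p \<in> fst D \<Longrightarrow> q \<in> fst D \<Longrightarrow> suc_link D (lower i p) (lower i q) (1/2 * snd D p q)"

definition suc_diamond :: "diamond_space \<Rightarrow> diamond_space" where
  "suc_diamond D = ((\<Union>i. upper i ` fst D \<union> lower i ` fst D), path_dist (suc_link D))"

inductive limit_link :: "(nat \<Rightarrow> diamond_space) \<Rightarrow> point \<Rightarrow> point \<Rightarrow> real \<Rightarrow> bool" for D where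
  "p \<in> fst (D n) \<Longrightarrow> q \<in> fst (D n) \<Longrightarrow> limit_link D (part n p) (part n q) (snd (D n) p q)"

definition limit_diamond :: "(nat \<Rightarrow> diamond_space) \<Rightarrow> diamond_space" where
  "limit_diamond D = ((\<Union>n. part n ` fst (D n)), path_dist (limit_link D))"

text \<open>
  A choice, for every countable limit ordinal \<open>\<alpha>\<close>, of an enumeration of the ordinals below \<open>\<alpha>\<close>
  (repetitions are permitted).
\<close>

locale ordinal_enumeration =
  fixes enum :: "countable_ordinal \<Rightarrow> nat \<Rightarrow> countable_ordinal"
  assumes range_enum: "is_limit \<alpha> \<Longrightarrow> range (enum \<alpha>) = {..<\<alpha>}"
begin

function diamond :: "countable_ordinal \<Rightarrow> diamond_space" where
  "diamond \<alpha> =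
    (if \<alpha> = 0 then zero_diamond
     else if is_limit \<alpha> then limit_diamond (\<lambda>n. diamond (enum \<alpha> n))
     else suc_diamond (diamond (ord_pred \<alpha>)))"
  by auto

termination
proof (relation "{(\<beta>, \<alpha>). \<beta> < \<alpha>}")
  show "wf {(\<beta>, \<alpha>). \<beta> < (\<alpha> :: countable_ordinal)}" by (rule wf)
next
  fix \<alpha> n assume "is_limit \<alpha>"
  thus "(enum \<alpha> n, \<alpha>) \<in> {(\<beta>, \<alpha>). \<beta> < \<alpha>}" using range_enum by auto
next
  fix \<alpha> assume "\<alpha> \<noteq> 0" "\<not> is_limit \<alpha>"
  thus "(ord_pred \<alpha>, \<alpha>) \<in> {(\<beta>, \<alpha>). \<beta> < \<alpha>}"
    by (cases \<alpha> rule: ordinal_cases) (auto simp: less_ord_suc)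
qed

declare diamond.simps [simp del]

lemma diamond_zero: "diamond 0 = zero_diamond"
  by (subst diamond.simps) simp

lemma diamond_suc: "diamond (ord_suc \<alpha>) = suc_diamond (diamond \<alpha>)"
  by (subst diamond.simps) simp

lemma diamond_limit: "is_limit \<alpha> \<Longrightarrow> diamond \<alpha> = limit_diamond (\<lambda>n. diamond (enum \<alpha> n))"
  by (subst diamond.simps) (auto simp: is_limit_def)

definition diamond_points :: "countable_ordinal \<Rightarrow> point set" where
  "diamond_points \<alpha> = fst (diamond \<alpha>)"

definition diamond_dist :: "countable_ordinal \<Rightarrow> point \<Rightarrow> point \<Rightarrow> real" where
  "diamond_dist \<alpha> = snd (diamond \<alpha>)"

end

lemma ex_ordinal_enumeration: "\<exists>enum. ordinal_enumeration enum"
proof -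
  have "\<exists>f :: nat \<Rightarrow> _. range f = {..<\<alpha>}" if "is_limit \<alpha>" for \<alpha>
  proof -
    have "0 < \<alpha>" using that zero_le_ordinal[of \<alpha>] by (auto simp: is_limit_def less_le)
    hence "{..<\<alpha>} \<noteq> {}" by blast
    thus ?thesis using countable_below by (metis range_from_nat_into)
  qed
  then obtain enum :: "countable_ordinal \<Rightarrow> nat \<Rightarrow> countable_ordinal"
    where "\<And>\<alpha>. is_limit \<alpha> \<Longrightarrow> range (enum \<alpha>) = {..<\<alpha>}" by metis
  hence "ordinal_enumeration enum" by unfold_locales
  thus ?thesis by blast
qed

text \<open>
  The successor step also yields $D_1^\omega$: the complete bipartite graph between
  $\{t_1,b_1\}$ and $\{x_1^i : i\in\omega\}$ with half its shortest path metric.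
\<close>

lemma (in ordinal_enumeration) diamond_points_one:
  "diamond_points (ord_suc 0) = {Top, Bot} \<union> range Mid"
  by (auto simp: diamond_points_def diamond_suc diamond_zero suc_diamond_def zero_diamond_def
      upper_def lower_def)

lemma (in ordinal_enumeration) diamond_dist_one:
  assumes xy: "x \<in> diamond_points (ord_suc 0)" "y \<in> diamond_points (ord_suc 0)"
  shows "diamond_dist (ord_suc 0) x y =
    (if x = y then 0 else if (x \<in> range Mid) \<noteq> (y \<in> range Mid) then 1/2 else 1)"
proof -
  define \<delta> :: "point \<Rightarrow> point \<Rightarrow> real" where
    "\<delta> x y = (if x = y then 0 else if (x \<in> range Mid) \<noteq> (y \<in> range Mid) then 1/2 else 1)" for x y
  let ?L = "suc_link zero_diamond"
  have L: "?L u v r \<Longrightarrow> r = \<delta> u v" for u v r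
    by (erule suc_link.cases) (auto simp: \<delta>_def zero_diamond_def upper_def lower_def)
  have tri: "\<delta> u w \<le> \<delta> u v + \<delta> v w" for u v w by (auto simp: \<delta>_def)
  have lower: "chain ?L u v r \<Longrightarrow> \<delta> u v \<le> r" for u v r
  proof (induction rule: chain.induct)
    case (chain_step x y r z s)
    thus ?case using L[of x y r] tri[of x z y] by simp
  qed (simp add: \<delta>_def)
  have TM: "?L Top (Mid i) (1/2)" "?L (Mid i) Top (1/2)" for i
    using suc_link.intros(1)[of Top zero_diamond Bot i] suc_link.intros(1)[of Bot zero_diamond Top i]
    by (auto simp: zero_diamond_def upper_def)
  have BM: "?L Bot (Mid i) (1/2)" "?L (Mid i) Bot (1/2)" for i
    using suc_link.intros(2)[of Top zero_diamond Bot i] suc_link.intros(2)[of Bot zero_diamond Top i]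
    by (auto simp: zero_diamond_def lower_def)
  have one: "?L u v (1/2) \<Longrightarrow> chain ?L u v (1/2)" for u v
    using chain.chain_step[of ?L u v "1/2" v 0] by (simp add: chain.chain_refl)
  have two: "?L u v (1/2) \<Longrightarrow> ?L v w (1/2) \<Longrightarrow> chain ?L u w 1" for u v w
    using chain.chain_step[of ?L u v "1/2" w "1/2"] one[of v w] by simp
  have att: "chain ?L x y (\<delta> x y)"
    using xy unfolding diamond_points_one \<delta>_def
    by (auto simp: chain.chain_refl intro: one TM BM two[OF TM(1) BM(2)] two[OF BM(1) TM(2)]
        two[OF TM(2) TM(1)])
  have "Inf {r. chain ?L x y r} = \<delta> x y"
    by (rule cInf_eq_minimum) (use att lower in auto)
  thus ?thesis
    by (simp add: diamond_dist_def diamond_suc diamond_zero suc_diamond_def path_dist_def \<delta>_def)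
qed


section \<open>The Banach space \<open>L\<^sub>1[0,1]\<close>\<close>

abbreviation unit_lebesgue :: "real measure" where
  "unit_lebesgue \<equiv> lebesgue_on {0..1}"

definition L1_rel :: "(real \<Rightarrow> real) \<Rightarrow> (real \<Rightarrow> real) \<Rightarrow> bool" where
  "L1_rel f g \<longleftrightarrow> integrable unit_lebesgue f \<and> integrable unit_lebesgue g \<and>
    (AE t in unit_lebesgue. f t = g t)"

quotient_type L1 = "real \<Rightarrow> real" / partial: L1_rel
proof (rule part_equivpI)
  show "\<exists>f. L1_rel f f" by (rule exI[of _ "\<lambda>_. 0"]) (simp add: L1_rel_def)
  show "symp L1_rel" by (auto simp: symp_def L1_rel_def elim: eventually_mono)
  show "transp L1_rel" by (auto simp: transp_def L1_rel_def elim: eventually_elim2)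
qed

instantiation L1 :: real_normed_vector
begin

lift_definition zero_L1 :: L1 is "\<lambda>_. 0" by (simp add: L1_rel_def)

lift_definition plus_L1 :: "L1 \<Rightarrow> L1 \<Rightarrow> L1" is "\<lambda>f g t. f t + g t"
  by (auto simp: L1_rel_def elim: eventually_elim2)

lift_definition minus_L1 :: "L1 \<Rightarrow> L1 \<Rightarrow> L1" is "\<lambda>f g t. f t - g t"
  by (auto simp: L1_rel_def elim: eventually_elim2)

lift_definition uminus_L1 :: "L1 \<Rightarrow> L1" is "\<lambda>f t. - f t"
  by (auto simp: L1_rel_def elim: eventually_mono)

lift_definition scaleR_L1 :: "real \<Rightarrow> L1 \<Rightarrow> L1" is "\<lambda>c f t. c * f t"
  by (auto simp: L1_rel_def elim: eventually_mono)

lift_definition norm_L1 :: "L1 \<Rightarrow> real" is "\<lambda>f. integral\<^sup>L unit_lebesgue (\<lambda>t. \<bar>f t\<bar>)"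
  by (rule integral_cong_AE)
    (auto simp: L1_rel_def intro!: borel_measurable_abs borel_measurable_integrable elim: eventually_mono)

definition dist_L1 :: "L1 \<Rightarrow> L1 \<Rightarrow> real" where "dist_L1 f g = norm (f - g)"

definition sgn_L1 :: "L1 \<Rightarrow> L1" where "sgn_L1 f = inverse (norm f) *\<^sub>R f"

definition uniformity_L1 :: "(L1 \<times> L1) filter" where
  [code del]: "uniformity_L1 = (INF e\<in>{0<..}. principal {(f, g). dist f g < e})"

definition open_L1 :: "L1 set \<Rightarrow> bool" where
  [code del]: "open_L1 U = (\<forall>f\<in>U. \<forall>\<^sub>F (f', g) in uniformity. f' = f \<longrightarrow> g \<in> U)"

instance
proof
  fix f g h :: L1 and a b :: real and U :: "L1 set"
  show "f + g + h = f + (g + h)" by transfer (auto simp: L1_rel_def add.assoc)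
  show "f + g = g + f" by transfer (auto simp: L1_rel_def add.commute)
  show "0 + f = f" by transfer (auto simp: L1_rel_def)
  show "- f + f = 0" by transfer (auto simp: L1_rel_def)
  show "f - g = f + - g" by transfer (auto simp: L1_rel_def)
  show "a *\<^sub>R (f + g) = a *\<^sub>R f + a *\<^sub>R g" by transfer (auto simp: L1_rel_def algebra_simps)
  show "(a + b) *\<^sub>R f = a *\<^sub>R f + b *\<^sub>R f" by transfer (auto simp: L1_rel_def algebra_simps)
  show "a *\<^sub>R b *\<^sub>R f = (a * b) *\<^sub>R f" by transfer (auto simp: L1_rel_def algebra_simps)
  show "1 *\<^sub>R f = f" by transfer (auto simp: L1_rel_def)
  show "dist f g = norm (f - g)" by (rule dist_L1_def)
  show "sgn f = inverse (norm f) *\<^sub>R f" by (rule sgn_L1_def)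
  show "uniformity = (INF e\<in>{0<..}. principal {(f, g :: L1). dist f g < e})"
    by (rule uniformity_L1_def)
  show "open U = (\<forall>f\<in>U. \<forall>\<^sub>F (f', g) in uniformity. f' = f \<longrightarrow> g \<in> U)" by (rule open_L1_def)
  show "norm f = 0 \<longleftrightarrow> f = 0"
  proof transfer
    fix f assume "L1_rel f f"
    hence f: "integrable unit_lebesgue f" by (simp add: L1_rel_def)
    hence "(LINT t|unit_lebesgue. \<bar>f t\<bar>) = 0 \<longleftrightarrow> (AE t in unit_lebesgue. \<bar>f t\<bar> = 0)"
      by (intro integral_nonneg_eq_0_iff_AE) auto
    thus "(LINT t|unit_lebesgue. \<bar>f t\<bar>) = 0 \<longleftrightarrow> L1_rel f (\<lambda>_. 0)" using f by (simp add: L1_rel_def)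
  qed
  show "norm (f + g) \<le> norm f + norm g"
  proof transfer
    fix f g assume "L1_rel f f" "L1_rel g g"
    hence fg: "integrable unit_lebesgue f" "integrable unit_lebesgue g" by (auto simp: L1_rel_def)
    hence "(LINT t|unit_lebesgue. \<bar>f t + g t\<bar>) \<le> (LINT t|unit_lebesgue. \<bar>f t\<bar> + \<bar>g t\<bar>)"
      by (intro integral_mono) auto
    also have "\<dots> = (LINT t|unit_lebesgue. \<bar>f t\<bar>) + (LINT t|unit_lebesgue. \<bar>g t\<bar>)"
      using fg by (intro Bochner_Integration.integral_add) auto
    finally show "(LINT t|unit_lebesgue. \<bar>f t + g t\<bar>) \<le>
      (LINT t|unit_lebesgue. \<bar>f t\<bar>) + (LINT t|unit_lebesgue. \<bar>g t\<bar>)" .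
  qed
  show "norm (a *\<^sub>R f) = \<bar>a\<bar> * norm f"
    by transfer (simp add: abs_mult)
qed

end

end

theory Submission
  imports Defs "HOL-Probability.Probability"
begin

text \<open>
  Send \<open>x\<close> to the indicator function of a measurable set \<open>S x\<close>, so that the $L_1$ distance of two
  images is the measure of a symmetric difference. The set of the top is everything, the set of the
  bottom is empty. Every point \<open>x\<close> of a diamond lies on a geodesic from top to bottom, and
  \<open>S x\<close> has measure equal to the distance from \<open>x\<close> to the bottom.

  The sets are built by transfinite induction over an arbitrary probability space that carries
  pairwise independent measure preserving maps \<open>\<phi> i\<close> into itself and an event \<open>H\<close> of probability
  $1/2$. At a limit ordinal, the cuts of the $n$-th part are pulled back along \<open>\<phi> n\<close>. At a successor,
  the midpoint $x^i$ becomes a copy of \<open>H\<close>; the cuts of the copy of $D_\alpha^\omega$ above $x^i$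
  interpolate between this set and the whole space, those of the copy below interpolate between the
  empty set and this set, in both cases at half scale; then everything is pulled back along \<open>\<phi> i\<close>.

  The map is 1-Lipschitz because it is so on each link of the shortest path metric. For the lower
  bound, two points of the same branch inherit the estimate from the smaller diamond, or are
  comparable, in which case their sets are nested and nothing is lost. Two points of different
  branches have independent sets. With $a$ and $b$ the measures of these sets, the points are at
  distance at most $\min(a+b, 2-(a+b))$, by passing through the bottom or the top, while the symmetric
  difference has measure $a + b - 2ab \ge s - s^2/2$, where $s = a + b$; and
  $2s - s^2 = s(2-s) \ge \min(s, 2-s)$ on $[0,2]$. This is the lemma
  \<open>min_le_twice_independent_symmetric_difference\<close>, and it is where the constant $1/2$ comes from.
  The gluing itself is \<open>cut_embedding_path_dist\<close>.

  An infinite sequence of fair coin flips provides the maps \<open>\<phi> i\<close>: split it into infinitely many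
  disjoint infinite blocks. The unit interval carries such a sequence, since the quantile function
  of the Cantor distribution is a random variable on it whose ternary digits are fair coin flips.
\<close>

section \<open>Bounds for shortest path metrics\<close>

text \<open>
  The path metric is an infimum; upper bounds on it only ever come from exhibiting one chain, so
  the bounds are composed at the level of chains, before the infimum is taken.
\<close>
definition reachable :: "('p \<Rightarrow> 'p \<Rightarrow> real \<Rightarrow> bool) \<Rightarrow> 'p \<Rightarrow> 'p \<Rightarrow> real \<Rightarrow> bool" where
  "reachable L x y c \<longleftrightarrow> (\<exists>r\<le>c. chain L x y r)"

lemma chain_trans: "chain L x y r \<Longrightarrow> chain L y z s \<Longrightarrow> chain L x z (r + s)"
  by (induction rule: chain.induct) (auto intro: chain.chain_step simp: add.assoc)

lemma chain_link: "L x y r \<Longrightarrow> chain L x y r"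
  using chain.chain_step[of L x y r y 0] by (simp add: chain.chain_refl)

lemma chain_sym:
  assumes "\<And>x y r. L x y r \<Longrightarrow> L y x r" and "chain L x y r"
  shows "chain L y x r"
  using assms(2)
proof (induction rule: chain.induct)
  case (chain_step x y r z s)
  thus ?case using chain_trans[OF chain_step.IH chain_link[of L y x r, OF assms(1)[OF chain_step.hyps(1)]]]
    by (simp add: add.commute)
qed (rule chain.chain_refl)

lemma reachable_link: "L x y r \<Longrightarrow> r \<le> c \<Longrightarrow> reachable L x y c"
  unfolding reachable_def using chain_link by metis

lemma reachable_trans:
  assumes "reachable L x y a" "reachable L y z b" "a + b \<le> c"
  shows "reachable L x z c"
proof -
  obtain r s where "r \<le> a" "chain L x y r" "s \<le> b" "chain L y z s"
    using assms unfolding reachable_def by blast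
  thus ?thesis using chain_trans[of L x y r z s] assms(3)
    unfolding reachable_def by (intro exI[of _ "r + s"]) auto
qed

lemma reachable_sym:
  assumes "\<And>x y r. L x y r \<Longrightarrow> L y x r" and "reachable L x y c"
  shows "reachable L y x c"
  using assms(2) chain_sym[of L, OF assms(1)] unfolding reachable_def by blast

lemma path_dist_sym:
  assumes "\<And>x y r. L x y r \<Longrightarrow> L y x r"
  shows "path_dist L x y = path_dist L y x"
proof -
  have "{r. chain L x y r} = {r. chain L y x r}"
    using chain_sym[of L, OF assms] by blast
  thus ?thesis unfolding path_dist_def by simp
qed

text \<open>
  The infimum of a set of reals is a lower bound of it only if the set is bounded below, and
  dominates every lower bound only if the set is nonempty. This explains the nonnegativity of the
  costs here and the presence of the bound \<open>c\<close> in the next lemma.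
\<close>

lemma path_dist_le:
  assumes "reachable L x y c" and "\<And>r. chain L x y r \<Longrightarrow> 0 \<le> r"
  shows "path_dist L x y \<le> c"
proof -
  obtain r where r: "r \<le> c" "chain L x y r" using assms(1) unfolding reachable_def by blast
  have "path_dist L x y \<le> r"
    unfolding path_dist_def using r(2) assms(2) by (intro cInf_lower) (auto intro: bdd_belowI[of _ 0])
  thus ?thesis using r(1) by simp
qed

lemma path_dist_ge:
  assumes "reachable L x y c" and "\<And>r. chain L x y r \<Longrightarrow> a \<le> r"
  shows "a \<le> path_dist L x y"
  unfolding path_dist_def using assms by (intro cInf_greatest) (auto simp: reachable_def)

section \<open>Cut embeddings and gluing\<close>

text \<open>
  For independent events of probabilities \<open>a\<close> and \<open>b\<close>, the right-hand side is twice the probability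
  of their symmetric difference; the left-hand side is the cheaper of the two detours, through the
  bottom or through the top. Given the sum $s$, the product is largest for $a = b$, which leaves
  $\min(s, 2-s) \le s(2-s)$.
\<close>

lemma min_le_twice_independent_symmetric_difference:
  fixes a b :: real
  assumes "0 \<le> a" "a \<le> 1" "0 \<le> b" "b \<le> 1"
  shows "min (a + b) (2 - (a + b)) \<le> 2 * (a + b - 2 * (a * b))"
proof -
  define s where "s = a + b"
  have "0 \<le> (a - b)\<^sup>2" by simp
  hence ab: "4 * (a * b) \<le> s * s" unfolding s_def by (simp add: power2_eq_square algebra_simps)
  have s: "0 \<le> s" "s \<le> 2" using assms unfolding s_def by auto
  have "min s (2 - s) \<le> 2 * s - s * s"
  proof (cases "s \<le> 1")
    case True
    hence "s * s \<le> s" using s mult_left_mono[of s 1 s] by simp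
    thus ?thesis using True by simp
  next
    case False
    hence "0 \<le> (s - 1) * (2 - s)" using s by (intro mult_nonneg_nonneg) auto
    thus ?thesis using False by (simp add: algebra_simps)
  qed
  also have "\<dots> \<le> 2 * (s - 2 * (a * b))" using ab by (simp add: algebra_simps)
  finally have "min s (2 - s) \<le> 2 * (s - 2 * (a * b))" .
  thus ?thesis unfolding s_def .
qed

text \<open>
  Requiring the sample space to be the whole type lets preimages be written without intersecting
  them with the space.
\<close>

locale full_prob_space = prob_space +
  assumes space_UNIV: "space M = UNIV"
begin

lemma prob_sym_diff:
  assumes "A \<in> events" "B \<in> events"
  shows "prob (sym_diff A B) = prob A + prob B - 2 * prob (A \<inter> B)"
proof -
  have "prob (sym_diff A B) = prob (A - B) + prob (B - A)"
    using assms by (intro finite_measure_Union) auto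
  also have "prob (A - B) = prob A - prob (A \<inter> B)" using assms by (rule finite_measure_Diff')
  also have "prob (B - A) = prob B - prob (A \<inter> B)"
    using finite_measure_Diff'[OF assms(2,1)] by (simp add: Int_commute)
  finally show ?thesis by simp
qed

lemma prob_sym_diff_triangle:
  assumes "A \<in> events" "B \<in> events" "C \<in> events"
  shows "prob (sym_diff A C) \<le> prob (sym_diff A B) + prob (sym_diff B C)"
proof -
  have "prob (sym_diff A C) \<le> prob (sym_diff A B \<union> sym_diff B C)"
    using assms by (intro finite_measure_mono) auto
  also have "\<dots> \<le> prob (sym_diff A B) + prob (sym_diff B C)"
    using assms by (intro measure_Un_le) auto
  finally show ?thesis .
qed

lemma prob_diff_le_sym_diff:
  assumes "A \<in> events" "B \<in> events"
  shows "prob A - prob B \<le> prob (sym_diff A B)"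
proof -
  have "prob (A \<inter> B) \<le> prob B" using assms by (intro finite_measure_mono) auto
  thus ?thesis using prob_sym_diff[OF assms] by simp
qed

text \<open>
  The bounds on the distances to top and bottom give the detours between different branches in the
  next step of the induction. By the 1-Lipschitz condition they are in fact equalities.
\<close>

definition cut_embedding :: "diamond_space \<Rightarrow> (point \<Rightarrow> 'a set) \<Rightarrow> bool" where
  "cut_embedding D S \<longleftrightarrow> Top \<in> fst D \<and> Bot \<in> fst D \<and> S Top = UNIV \<and> S Bot = {} \<and>
    (\<forall>p\<in>fst D. S p \<in> events \<and> snd D p Top \<le> 1 - prob (S p) \<and> snd D p Bot \<le> prob (S p)) \<and>
    (\<forall>p\<in>fst D. \<forall>q\<in>fst D. snd D p q = snd D q p \<and>
      prob (sym_diff (S p) (S q)) \<le> snd D p q \<and> snd D p q \<le> 2 * prob (sym_diff (S p) (S q)))"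

lemma cut_embeddingD:
  assumes "cut_embedding D S"
  shows "Top \<in> fst D" "Bot \<in> fst D" "S Top = UNIV" "S Bot = {}"
    and "p \<in> fst D \<Longrightarrow> S p \<in> events"
    and "p \<in> fst D \<Longrightarrow> snd D p Top \<le> 1 - prob (S p)"
    and "p \<in> fst D \<Longrightarrow> snd D p Bot \<le> prob (S p)"
    and "p \<in> fst D \<Longrightarrow> q \<in> fst D \<Longrightarrow> snd D p q = snd D q p"
    and "p \<in> fst D \<Longrightarrow> q \<in> fst D \<Longrightarrow> prob (sym_diff (S p) (S q)) \<le> snd D p q"
    and "p \<in> fst D \<Longrightarrow> q \<in> fst D \<Longrightarrow> snd D p q \<le> 2 * prob (sym_diff (S p) (S q))"
  using assms unfolding cut_embedding_def by blast+

lemma cut_embedding_zero: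
  "cut_embedding zero_diamond (\<lambda>p. if p = Top then UNIV else {})"
  using prob_space space_UNIV sets.top[of M]
  by (auto simp: cut_embedding_def zero_diamond_def)

text \<open>
  The gluing principle. The 1-Lipschitz bound need only be checked on links, by the triangle
  inequality for the measure of symmetric differences. For the lower bound, two points are either
  joined by a short chain (points of one branch), or have independent cuts (points of different
  branches), and then a detour through top or bottom is short enough.
\<close>

lemma cut_embedding_path_dist:
  assumes TB: "Top \<in> P" "Bot \<in> P" "S Top = UNIV" "S Bot = {}"
    and ev: "\<And>x. x \<in> P \<Longrightarrow> S x \<in> events"
    and sym: "\<And>x y r. L x y r \<Longrightarrow> L y x r"
    and link: "\<And>x y r. L x y r \<Longrightarrow> x \<in> P \<and> y \<in> P \<and> prob (sym_diff (S x) (S y)) \<le> r"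
    and top: "\<And>x. x \<in> P \<Longrightarrow> reachable L x Top (1 - prob (S x))"
    and bot: "\<And>x. x \<in> P \<Longrightarrow> reachable L x Bot (prob (S x))"
    and near: "\<And>x y. x \<in> P \<Longrightarrow> y \<in> P \<Longrightarrow>
      reachable L x y (2 * prob (sym_diff (S x) (S y))) \<or> prob (S x \<inter> S y) = prob (S x) * prob (S y)"
  shows "cut_embedding (P, path_dist L) S"
proof -
  have lip: "x \<in> P \<longrightarrow> y \<in> P \<and> prob (sym_diff (S x) (S y)) \<le> r" if "chain L x y r" for x y r
    using that
  proof (induction rule: chain.induct)
    case (chain_step x y r z s)
    show ?case
      using chain_step.IH link[OF chain_step.hyps(1)] prob_sym_diff_triangle[OF ev ev ev, of x y z]
      by force
  qed simp
  have nonneg: "0 \<le> r" if "chain L x y r" "x \<in> P" for x y r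
    using lip[OF that(1)] that(2) measure_nonneg[of M "sym_diff (S x) (S y)"] order_trans by blast
  have reach: "reachable L x y (2 * prob (sym_diff (S x) (S y)))" if xy: "x \<in> P" "y \<in> P" for x y
  proof (cases "prob (S x \<inter> S y) = prob (S x) * prob (S y)")
    case True
    let ?a = "prob (S x)" and ?b = "prob (S y)"
    have "min (?a + ?b) (2 - (?a + ?b)) \<le> 2 * prob (sym_diff (S x) (S y))"
      unfolding prob_sym_diff[OF ev ev, OF xy] True
      by (rule min_le_twice_independent_symmetric_difference) auto
    hence "?a + ?b \<le> 2 * prob (sym_diff (S x) (S y)) \<or>
      (1 - ?a) + (1 - ?b) \<le> 2 * prob (sym_diff (S x) (S y))"
      by (auto simp: min_def split: if_splits)
    thus ?thesis
      using reachable_trans[OF bot[OF xy(1)] reachable_sym[of L, OF sym bot[OF xy(2)]]]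
        reachable_trans[OF top[OF xy(1)] reachable_sym[of L, OF sym top[OF xy(2)]]] by blast
  qed (use near xy in blast)
  show ?thesis
    unfolding cut_embedding_def fst_conv snd_conv
  proof (intro conjI ballI)
    fix x assume x: "x \<in> P"
    show "path_dist L x Top \<le> 1 - prob (S x)" "path_dist L x Bot \<le> prob (S x)"
      using path_dist_le[OF top[OF x]] path_dist_le[OF bot[OF x]] nonneg x by blast+
    fix y assume y: "y \<in> P"
    show "path_dist L x y = path_dist L y x" using path_dist_sym[of L, OF sym] by blast
    show "prob (sym_diff (S x) (S y)) \<le> path_dist L x y"
      using path_dist_ge[OF reach[OF x y]] lip x by blast
    show "path_dist L x y \<le> 2 * prob (sym_diff (S x) (S y))"
      using path_dist_le[OF reach[OF x y]] nonneg x by blast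
  qed (use TB ev in auto)
qed

end

section \<open>Successor and limit diamonds\<close>

text \<open>
  Each \<open>\<phi> i\<close> provides an independent copy of the probability space inside itself. Independence is
  required for pairs only, as the estimates involve two points at a time. Taking \<open>B\<close> to be the whole
  space shows that the maps preserve the measure.
\<close>

locale independent_copies = full_prob_space +
  fixes \<phi> :: "nat \<Rightarrow> 'a \<Rightarrow> 'a" and H :: "'a set"
  assumes measurable_copy [measurable]: "\<phi> i \<in> measurable M M"
    and prob_copy_Int: "i \<noteq> j \<Longrightarrow> A \<in> events \<Longrightarrow> B \<in> events \<Longrightarrow>
      prob (\<phi> i -` A \<inter> \<phi> j -` B) = prob A * prob B"
    and half_event: "H \<in> events" and prob_half: "prob H = 1 / 2"
begin

lemma copy_event: "A \<in> events \<Longrightarrow> \<phi> i -` A \<in> events"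
  using measurable_sets[OF measurable_copy, of A i] by (simp add: space_UNIV)

lemma prob_copy: "A \<in> events \<Longrightarrow> prob (\<phi> i -` A) = prob A"
  using prob_copy_Int[of i "Suc i" A UNIV] sets.top[of M] prob_space space_UNIV by simp

text \<open>
  Copy \<open>i\<close> is subdivided once more: its subcopy \<open>0\<close> supplies the event of probability $1/2$ that cuts
  off the midpoint $x^i$, and its subcopy \<open>1\<close>, independent of that event, supplies the cuts of the
  smaller diamond. Conditioning on the event or on its complement halves all measures, in accordance
  with the factor $1/2$ in the metric.
\<close>

definition upper_cut :: "nat \<Rightarrow> 'a set \<Rightarrow> 'a set" where
  "upper_cut i A = \<phi> i -` (\<phi> 0 -` H \<union> \<phi> 1 -` A)"

definition lower_cut :: "nat \<Rightarrow> 'a set \<Rightarrow> 'a set" where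
  "lower_cut i A = \<phi> i -` (\<phi> 0 -` H \<inter> \<phi> 1 -` A)"

lemma lower_cut:
  assumes "A \<in> events"
  shows "lower_cut i A \<in> events" "prob (lower_cut i A) = prob A / 2"
proof -
  have e: "\<phi> 0 -` H \<in> events" "\<phi> 1 -` A \<in> events" using assms half_event copy_event by blast+
  show "lower_cut i A \<in> events" unfolding lower_cut_def by (rule copy_event[OF sets.Int[OF e]])
  show "prob (lower_cut i A) = prob A / 2"
    unfolding lower_cut_def prob_copy[OF sets.Int[OF e]] using assms half_event
    by (subst prob_copy_Int) (auto simp: prob_half)
qed

lemma upper_cut:
  assumes "A \<in> events"
  shows "upper_cut i A \<in> events" "prob (upper_cut i A) = 1 / 2 + prob A / 2"
proof -
  have e: "\<phi> 0 -` H \<in> events" "\<phi> 1 -` A \<in> events" using assms half_event copy_event by blast+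
  show "upper_cut i A \<in> events" unfolding upper_cut_def by (rule copy_event[OF sets.Un[OF e]])
  have "prob (\<phi> 0 -` H \<union> \<phi> 1 -` A) =
      prob (\<phi> 0 -` H) + prob (\<phi> 1 -` A) - prob (\<phi> 0 -` H \<inter> \<phi> 1 -` A)"
    using e by (intro measure_Un3) (auto simp: fmeasurable_eq_sets)
  also have "\<dots> = 1 / 2 + prob A - prob A / 2"
    using assms half_event prob_copy_Int[of 0 1 H A] by (simp add: prob_copy prob_half)
  finally show "prob (upper_cut i A) = 1 / 2 + prob A / 2"
    unfolding upper_cut_def prob_copy[OF sets.Un[OF e]] by simp
qed

lemma prob_sym_diff_lower_cut:
  assumes "A \<in> events" "B \<in> events"
  shows "prob (sym_diff (lower_cut i A) (lower_cut i B)) = prob (sym_diff A B) / 2"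
proof -
  have "sym_diff (lower_cut i A) (lower_cut i B) = lower_cut i (sym_diff A B)"
    unfolding lower_cut_def by auto
  thus ?thesis using lower_cut(2)[of "sym_diff A B" i] assms by auto
qed

lemma prob_sym_diff_upper_cut:
  assumes "A \<in> events" "B \<in> events"
  shows "prob (sym_diff (upper_cut i A) (upper_cut i B)) = prob (sym_diff A B) / 2"
proof -
  have "upper_cut i A \<inter> upper_cut i B = upper_cut i (A \<inter> B)"
    unfolding upper_cut_def by auto
  thus ?thesis using assms by (simp add: prob_sym_diff upper_cut sets.Int field_simps)
qed

lemma prob_copy_sym_diff:
  assumes "A \<in> events" "B \<in> events"
  shows "prob (sym_diff (\<phi> i -` A) (\<phi> i -` B)) = prob (sym_diff A B)"
proof -
  have "sym_diff (\<phi> i -` A) (\<phi> i -` B) = \<phi> i -` (sym_diff A B)" by auto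
  thus ?thesis using prob_copy[of "sym_diff A B" i] assms by auto
qed

text \<open>
  The value at \<open>Mid i\<close> is at once the upper cut of the smaller bottom and the lower cut of the smaller
  top. Points \<open>Part n p\<close> do not occur in a successor diamond, and their value is a dummy.
\<close>

primrec suc_cut :: "(point \<Rightarrow> 'a set) \<Rightarrow> point \<Rightarrow> 'a set" where
  "suc_cut S Top = UNIV"
| "suc_cut S Bot = {}"
| "suc_cut S (Mid i) = upper_cut i {}"
| "suc_cut S (Upper i p) = upper_cut i (S p)"
| "suc_cut S (Lower i p) = lower_cut i (S p)"
| "suc_cut S (Part n p) = {}"

lemma suc_cut_upper_lower:
  assumes "S Top = UNIV" "S Bot = {}"
  shows "suc_cut S (upper i p) = upper_cut i (S p)" "suc_cut S (lower i p) = lower_cut i (S p)"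
  using assms by (auto simp: upper_def lower_def upper_cut_def lower_cut_def)

lemma upper_lower_glued:
  "upper i Top = Top" "upper i Bot = Mid i" "lower i Top = Mid i" "lower i Bot = Bot"
  by (auto simp: upper_def lower_def)

text \<open>
  The only new case is that of two points in the upper and the lower half of the same branch. The
  chain through \<open>Mid i\<close> between them has cost equal to the difference of their measures, and this is
  at most the measure of the symmetric difference. The chains from a lower point to the top and from
  an upper point to the bottom are instances of this.
\<close>

lemma cut_embedding_suc:
  assumes D: "cut_embedding D S"
  shows "cut_embedding (suc_diamond D) (suc_cut S)"
proof -
  note D' = cut_embeddingD[OF D]
  note S = suc_cut_upper_lower[of S, OF D'(3,4)]
  let ?P = "\<Union>i. upper i ` fst D \<union> lower i ` fst D" and ?L = "suc_link D"
  have Dtop: "snd D Top p \<le> 1 - prob (S p)" and Dbot: "snd D Bot p \<le> prob (S p)"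
    if "p \<in> fst D" for p
    using D'(6,7)[OF that] D'(8)[OF that D'(1)] D'(8)[OF that D'(2)] by simp_all
  have up: "reachable ?L (upper i p) (upper i q) c"
    if "p \<in> fst D" "q \<in> fst D" "1/2 * snd D p q \<le> c" for i p q c
    using suc_link.intros(1)[OF that(1,2)] that(3) by (rule reachable_link)
  have low: "reachable ?L (lower i p) (lower i q) c"
    if "p \<in> fst D" "q \<in> fst D" "1/2 * snd D p q \<le> c" for i p q c
    using suc_link.intros(2)[OF that(1,2)] that(3) by (rule reachable_link)
  have down: "reachable ?L (upper i p) (lower i q) ((1 + prob (S p) - prob (S q)) / 2)"
    if "p \<in> fst D" "q \<in> fst D" for i p q
  proof (rule reachable_trans)
    show "reachable ?L (upper i p) (Mid i) (prob (S p) / 2)"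
      using up[of p Bot "prob (S p) / 2" i] D'(2) D'(7)[of p] that by (simp add: upper_lower_glued)
    show "reachable ?L (Mid i) (lower i q) ((1 - prob (S q)) / 2)"
      using low[of Top q "(1 - prob (S q)) / 2" i] D'(1) Dtop[of q] that
      by (simp add: upper_lower_glued)
  qed (simp add: field_simps)
  have sym: "?L y x r" if "?L x y r" for x y r
    using that
  proof cases
    case (1 p q i)
    show ?thesis
      unfolding 1(1-3) D'(8)[OF 1(4,5)] by (rule suc_link.intros(1)[of q D p i, OF 1(5,4)])
  next
    case (2 p q i)
    show ?thesis
      unfolding 2(1-3) D'(8)[OF 2(4,5)] by (rule suc_link.intros(2)[of q D p i, OF 2(5,4)])
  qed
  have glue: "cut_embedding (?P, path_dist ?L) (suc_cut S)"
  proof (rule cut_embedding_path_dist)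
    show "Top \<in> ?P" "Bot \<in> ?P"
      using imageI[OF D'(1), of "upper 0"] imageI[OF D'(2), of "lower 0"]
      by (auto simp only: upper_lower_glued)
    show "suc_cut S Top = UNIV" "suc_cut S Bot = {}" by simp_all
    show "suc_cut S x \<in> events" if "x \<in> ?P" for x
      using that by (auto simp: S upper_cut lower_cut D')
    show "?L y x r" if "?L x y r" for x y r using sym[OF that] .
    show "x \<in> ?P \<and> y \<in> ?P \<and> prob (sym_diff (suc_cut S x) (suc_cut S y)) \<le> r"
      if "?L x y r" for x y r
      using that
    proof cases
      case (1 p q i)
      thus ?thesis using D'(9)[of p q] by (auto simp: S prob_sym_diff_upper_cut D'(5))
    next
      case (2 p q i)
      thus ?thesis using D'(9)[of p q] by (auto simp: S prob_sym_diff_lower_cut D'(5))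
    qed
    have cases_P: thesis if "x \<in> ?P"
      "\<And>i p. x = upper i p \<Longrightarrow> p \<in> fst D \<Longrightarrow> thesis"
      "\<And>i p. x = lower i p \<Longrightarrow> p \<in> fst D \<Longrightarrow> thesis" for x thesis
      using that by blast
    show "reachable ?L x Top (1 - prob (suc_cut S x))" if "x \<in> ?P" for x
      using that
    proof (rule cases_P)
      fix i p assume x: "x = upper i p" "p \<in> fst D"
      show ?thesis
        using up[of p Top "1 - prob (suc_cut S x)" i] D'(1) D'(6)[of p] x
        by (simp add: upper_lower_glued S upper_cut D')
    next
      fix i p assume x: "x = lower i p" "p \<in> fst D"
      have "reachable ?L (upper i Top) (lower i p) ((1 + prob (S Top) - prob (S p)) / 2)"
        using D'(1) x by (intro down)
      hence "reachable ?L Top x (1 - prob (suc_cut S x))"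
        using x prob_space space_UNIV by (simp add: upper_lower_glued S lower_cut D' field_simps)
      thus ?thesis using reachable_sym[of ?L, OF sym] by blast
    qed
    show "reachable ?L x Bot (prob (suc_cut S x))" if "x \<in> ?P" for x
      using that
    proof (rule cases_P)
      fix i p assume x: "x = lower i p" "p \<in> fst D"
      show ?thesis
        using low[of p Bot "prob (suc_cut S x)" i] D'(2) D'(7)[of p] x
        by (simp add: upper_lower_glued S lower_cut D')
    next
      fix i p assume x: "x = upper i p" "p \<in> fst D"
      have "reachable ?L (upper i p) (lower i Bot) ((1 + prob (S p) - prob (S Bot)) / 2)"
        using D'(2) x by (intro down)
      thus ?thesis using x by (simp add: upper_lower_glued S upper_cut D' field_simps)
    qed
    \<comment> \<open>Every cut of branch \<open>i\<close> is an event of copy \<open>i\<close>, whence the independence of different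
      branches. Top and bottom belong to every branch, and any choice of \<open>i\<close> will do for them.\<close>
    have copy: "\<exists>i. \<exists>A\<in>events. suc_cut S x = \<phi> i -` A \<and> (x \<in> upper i ` fst D \<or> x \<in> lower i ` fst D)"
      if "x \<in> ?P" for x
      using that
    proof (rule cases_P)
      fix i p assume "x = upper i p" "p \<in> fst D"
      thus ?thesis unfolding S upper_cut_def
        by (intro exI[of _ i] bexI[of _ "\<phi> 0 -` H \<union> \<phi> 1 -` S p"])
          (auto simp: S upper_cut_def copy_event half_event D')
    next
      fix i p assume "x = lower i p" "p \<in> fst D"
      thus ?thesis
        by (intro exI[of _ i] bexI[of _ "\<phi> 0 -` H \<inter> \<phi> 1 -` S p"])
          (auto simp: S lower_cut_def copy_event half_event D')
    qed
    have down': "reachable ?L (upper i p) (lower i q)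
        (2 * prob (sym_diff (suc_cut S (upper i p)) (suc_cut S (lower i q))))"
      if "p \<in> fst D" "q \<in> fst D" for i p q
    proof -
      let ?U = "upper_cut i (S p)" and ?V = "lower_cut i (S q)"
      have "prob ?U - prob ?V \<le> prob (sym_diff ?U ?V)"
        using that D' by (intro prob_diff_le_sym_diff upper_cut lower_cut)
      moreover have "prob ?U - prob ?V = (1 + prob (S p) - prob (S q)) / 2"
        using that by (simp add: upper_cut lower_cut D' field_simps)
      moreover have "0 \<le> prob (sym_diff ?U ?V)" by simp
      ultimately have "0 + (1 + prob (S p) - prob (S q)) / 2 \<le> 2 * prob (sym_diff ?U ?V)"
        by linarith
      thus ?thesis unfolding S
        using reachable_trans[OF _ down[OF that]] chain.chain_refl[of ?L "upper i p"]
        unfolding reachable_def by (meson order_refl order_trans add_0)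
    qed
    show "reachable ?L x y (2 * prob (sym_diff (suc_cut S x) (suc_cut S y))) \<or>
        prob (suc_cut S x \<inter> suc_cut S y) = prob (suc_cut S x) * prob (suc_cut S y)"
      if xy: "x \<in> ?P" "y \<in> ?P" for x y
    proof -
      obtain i A where i: "A \<in> events" "suc_cut S x = \<phi> i -` A"
        "x \<in> upper i ` fst D \<or> x \<in> lower i ` fst D" using copy[OF xy(1)] by blast
      obtain j B where j: "B \<in> events" "suc_cut S y = \<phi> j -` B"
        "y \<in> upper j ` fst D \<or> y \<in> lower j ` fst D" using copy[OF xy(2)] by blast
      show ?thesis
      proof (cases "i = j")
        case False
        thus ?thesis using i j by (simp add: prob_copy_Int prob_copy)
      next
        case True
        have "reachable ?L x y (2 * prob (sym_diff (suc_cut S x) (suc_cut S y)))"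
          using i(3) j(3)
        proof (elim disjE imageE)
          fix p q assume "x = upper i p" "y = upper j q" and "p \<in> fst D" "q \<in> fst D"
          thus ?thesis using True D'(10)[of p q]
            by (auto intro!: up simp: S prob_sym_diff_upper_cut D'(5))
        next
          fix p q assume "x = lower i p" "y = lower j q" and "p \<in> fst D" "q \<in> fst D"
          thus ?thesis using True D'(10)[of p q]
            by (auto intro!: low simp: S prob_sym_diff_lower_cut D'(5))
        next
          fix p q assume "x = upper i p" "y = lower j q" and "p \<in> fst D" "q \<in> fst D"
          thus ?thesis using True down' by simp
        next
          fix p q assume "x = lower i p" "y = upper j q" and "p \<in> fst D" "q \<in> fst D"
          thus ?thesis using True reachable_sym[of ?L, OF sym down'[of q p j]]
            by (simp add: Un_commute)
        qed
        thus ?thesis ..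
      qed
    qed
  qed
  thus ?thesis by (simp add: suc_diamond_def)
qed

text \<open>
  Apart from top and bottom, a limit diamond has only points \<open>Part n p\<close>; the other values are dummies.
\<close>

primrec limit_cut :: "(nat \<Rightarrow> point \<Rightarrow> 'a set) \<Rightarrow> point \<Rightarrow> 'a set" where
  "limit_cut S Top = UNIV"
| "limit_cut S Bot = {}"
| "limit_cut S (Mid i) = {}"
| "limit_cut S (Upper i p) = {}"
| "limit_cut S (Lower i p) = {}"
| "limit_cut S (Part n p) = \<phi> n -` S n p"

lemma cut_embedding_limit:
  assumes D: "\<And>n. cut_embedding (D n) (S n)"
  shows "cut_embedding (limit_diamond D) (limit_cut S)"
proof -
  note D' = cut_embeddingD[OF D]
  have S: "limit_cut S (part n p) = \<phi> n -` S n p" for n p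
    by (auto simp: part_def D')
  have glued: "part n Top = Top" "part n Bot = Bot" for n by (auto simp: part_def)
  let ?P = "\<Union>n. part n ` fst (D n)" and ?L = "limit_link D"
  have go: "reachable ?L (part n p) (part n q) c"
    if "p \<in> fst (D n)" "q \<in> fst (D n)" "snd (D n) p q \<le> c" for n p q c
    using limit_link.intros[of p D n q, OF that(1,2)] that(3) by (rule reachable_link)
  have "cut_embedding (?P, path_dist ?L) (limit_cut S)"
  proof (rule cut_embedding_path_dist)
    show "Top \<in> ?P" "Bot \<in> ?P"
      using imageI[OF D'(1), of "part 0" 0] imageI[OF D'(2), of "part 0" 0]
      by (auto simp only: glued)
    show "limit_cut S Top = UNIV" "limit_cut S Bot = {}" by simp_all
    show "limit_cut S x \<in> events" if "x \<in> ?P" for x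
      using that by (auto simp: S copy_event D')
    show "?L y x r" if "?L x y r" for x y r
      using that
    proof cases
      case (1 p n q)
      thus ?thesis using limit_link.intros[of q D n p] D'(8)[of p n q] by simp
    qed
    show "x \<in> ?P \<and> y \<in> ?P \<and> prob (sym_diff (limit_cut S x) (limit_cut S y)) \<le> r"
      if "?L x y r" for x y r
      using that
    proof cases
      case (1 p n q)
      thus ?thesis using D'(9)[of p n q] by (auto simp: S prob_copy_sym_diff D'(5))
    qed
    show "reachable ?L x Top (1 - prob (limit_cut S x))" if "x \<in> ?P" for x
    proof -
      obtain n p where x: "x = part n p" "p \<in> fst (D n)" using \<open>x \<in> ?P\<close> by blast
      thus ?thesis using go[of p n Top] D'(1,6) by (simp add: glued S prob_copy D'(5))
    qed
    show "reachable ?L x Bot (prob (limit_cut S x))" if "x \<in> ?P" for x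
    proof -
      obtain n p where x: "x = part n p" "p \<in> fst (D n)" using \<open>x \<in> ?P\<close> by blast
      thus ?thesis using go[of p n Bot] D'(2,7) by (simp add: glued S prob_copy D'(5))
    qed
    show "reachable ?L x y (2 * prob (sym_diff (limit_cut S x) (limit_cut S y))) \<or>
        prob (limit_cut S x \<inter> limit_cut S y) = prob (limit_cut S x) * prob (limit_cut S y)"
      if xy: "x \<in> ?P" "y \<in> ?P" for x y
    proof -
      obtain n p where x: "x = part n p" "p \<in> fst (D n)" using xy by blast
      obtain m q where y: "y = part m q" "q \<in> fst (D m)" using xy by blast
      show ?thesis
      proof (cases "n = m")
        case True
        thus ?thesis using x y go[of p n q] D'(10)[of p n q]
          by (simp add: S prob_copy_sym_diff D'(5))
      next
        case False
        thus ?thesis using x y by (simp add: S prob_copy_Int prob_copy D'(5))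
      qed
    qed
  qed
  thus ?thesis by (simp add: limit_diamond_def)
qed

lemma ex_cut_embedding_diamond:
  assumes "ordinal_enumeration enum"
  shows "\<exists>S. cut_embedding (ordinal_enumeration.diamond enum \<alpha>) S"
proof -
  interpret ordinal_enumeration enum by (rule assms)
  show ?thesis
  proof (induction \<alpha> rule: less_induct)
    case (less \<alpha>)
    show ?case
    proof (cases \<alpha> rule: ordinal_cases)
      case zero
      thus ?thesis using cut_embedding_zero by (auto simp: diamond_zero)
    next
      case (suc \<beta>)
      then obtain S where "cut_embedding (diamond \<beta>) S" using less less_ord_suc by blast
      thus ?thesis unfolding suc diamond_suc using cut_embedding_suc by blast
    next
      case limit
      have "\<exists>S. cut_embedding (diamond (enum \<alpha> n)) S" for n
        using less range_enum[OF limit] by blast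
      then obtain S where S: "\<And>n. cut_embedding (diamond (enum \<alpha> n)) (S n)" by metis
      show ?thesis
        unfolding diamond_limit[OF limit]
        using cut_embedding_limit[of "\<lambda>n. diamond (enum \<alpha> n)" S, OF S] by blast
    qed
  qed
qed

end

section \<open>Coin flips as independent copies\<close>

definition coins :: "(nat \<Rightarrow> bool) measure" where
  "coins = PiM UNIV (\<lambda>_. measure_pmf (bernoulli_pmf (1/2)))"

text \<open>
  Reading the outcomes at the positions that encode \<open>(i, n)\<close> for varying \<open>n\<close> gives, for each \<open>i\<close>, a
  fresh sequence of coin flips; the positions used for different \<open>i\<close> are disjoint.
\<close>

definition block :: "nat \<Rightarrow> (nat \<Rightarrow> bool) \<Rightarrow> nat \<Rightarrow> bool" where
  "block i \<omega> n = \<omega> (prod_encode (i, n))"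

interpretation coin: product_prob_space "\<lambda>_. measure_pmf (bernoulli_pmf (1/2))" "UNIV :: nat set"
  by standard

lemma space_coins: "space coins = UNIV"
  by (simp add: coins_def space_PiM)

lemma measurable_coin [measurable]: "(\<lambda>\<omega>. \<omega> n) \<in> measurable coins (count_space UNIV)"
proof -
  have "(\<lambda>\<omega>. \<omega> n) \<in> measurable coins (measure_pmf (bernoulli_pmf (1/2)))"
    unfolding coins_def by (rule measurable_component_singleton) simp
  thus ?thesis by simp
qed

text \<open>
  All sets of outcomes of a single coin are measurable, so the coordinates can be treated as maps
  into a discrete space.
\<close>

lemma measurable_coinsI:
  assumes "\<And>n. (\<lambda>x. f x n) \<in> measurable M (count_space UNIV)"
  shows "f \<in> measurable M coins"
  unfolding coins_def using assms by (intro measurable_PiM_single') auto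

lemma indep_coins: "prob_space.indep_vars coins (\<lambda>_. measure_pmf (bernoulli_pmf (1/2))) (\<lambda>n \<omega>. \<omega> n) UNIV"
proof -
  let ?C = "measure_pmf (bernoulli_pmf (1/2))"
  have "distr coins (PiM UNIV (\<lambda>_. ?C)) (\<lambda>\<omega>. \<lambda>n\<in>UNIV. \<omega> n) = coins"
    unfolding coins_def by (simp add: restrict_UNIV)
  moreover have "distr coins ?C (\<lambda>\<omega>. \<omega> n) = ?C" for n
    unfolding coins_def by (rule coin.PiM_component) simp
  ultimately show ?thesis
    unfolding coins_def using measurable_coin
    by (subst coin.indep_vars_iff_distr_eq_PiM') (auto simp: coins_def)
qed

lemma prob_coin: "measure coins {\<omega>. \<omega> n} = 1 / 2"
proof -
  have "measure coins {\<omega>. \<omega> n} = measure (distr coins (measure_pmf (bernoulli_pmf (1/2))) (\<lambda>\<omega>. \<omega> n)) {True}"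
    by (subst measure_distr) (auto simp: space_coins vimage_def)
  also have "distr coins (measure_pmf (bernoulli_pmf (1/2))) (\<lambda>\<omega>. \<omega> n) = measure_pmf (bernoulli_pmf (1/2))"
    unfolding coins_def by (rule coin.PiM_component) simp
  finally show ?thesis by (simp add: measure_pmf_single)
qed

interpretation coins: prob_space coins
  unfolding coins_def by (rule coin.prob_space_axioms)

lemma measurable_block: "block i \<in> measurable coins coins"
  unfolding block_def by (rule measurable_coinsI) (rule measurable_coin)

lemma distr_block: "distr coins coins (block i) = coins"
  using distr_PiM_reindex[of UNIV "\<lambda>_. measure_pmf (bernoulli_pmf (1/2))" "\<lambda>n. prod_encode (i, n)" UNIV]
  by (simp add: coins_def block_def[abs_def] inj_on_def measure_pmf.prob_space_axioms restrict_UNIV)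

text \<open>
  Families of coordinates over pairwise disjoint index sets are independent, and \<open>block i\<close> is a
  function of the coordinates with index in the range of \<open>\<lambda>n. prod_encode (i, n)\<close>.
\<close>

lemma indep_blocks: "coins.indep_vars (\<lambda>_. coins) block UNIV"
proof -
  let ?K = "\<lambda>i. range (\<lambda>n. prod_encode (i, n))" and ?C = "measure_pmf (bernoulli_pmf (1/2))"
  have "coins.indep_vars (\<lambda>i. PiM (?K i) (\<lambda>_. ?C)) (\<lambda>i \<omega>. restrict (\<lambda>n. \<omega> n) (?K i)) UNIV"
    by (rule coins.indep_vars_restrict[OF indep_coins]) (auto simp: disjoint_family_on_def)
  hence "coins.indep_vars (\<lambda>_. coins) (\<lambda>i \<omega>. (\<lambda>\<omega> n. \<omega> (prod_encode (i, n))) (restrict (\<lambda>n. \<omega> n) (?K i))) UNIV"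
  proof (rule coins.indep_vars_compose2)
    fix i :: nat
    show "(\<lambda>\<omega> n. \<omega> (prod_encode (i, n))) \<in> measurable (PiM (?K i) (\<lambda>_. ?C)) coins"
    proof (rule measurable_coinsI)
      fix n
      have "(\<lambda>\<omega>. \<omega> (prod_encode (i, n))) \<in> measurable (PiM (?K i) (\<lambda>_. ?C)) ?C"
        by (rule measurable_component_singleton) simp
      thus "(\<lambda>\<omega>. \<omega> (prod_encode (i, n))) \<in> measurable (PiM (?K i) (\<lambda>_. ?C)) (count_space UNIV)"
        by simp
    qed
  qed
  thus ?thesis by (simp add: block_def[abs_def])
qed

interpretation coins: independent_copies coins block "{\<omega>. \<omega> 0}"
proof
  show "space coins = UNIV" by (rule space_coins)
  show "block i \<in> measurable coins coins" for i by (rule measurable_block)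
  show "{\<omega>. \<omega> 0} \<in> coins.events"
    using measurable_sets[OF measurable_coin, of "{True}" 0] by (simp add: space_coins vimage_def)
  show "coins.prob {\<omega>. \<omega> 0} = 1 / 2" by (rule prob_coin)
  fix i j :: nat and A B
  assume ij: "i \<noteq> j" and AB: "A \<in> coins.events" "B \<in> coins.events"
  have "coins.prob (\<Inter>k\<in>{i, j}. block k -` (if k = i then A else B) \<inter> space coins) =
      (\<Prod>k\<in>{i, j}. coins.prob (block k -` (if k = i then A else B) \<inter> space coins))"
    using AB by (intro coins.indep_varsD[OF indep_blocks]) auto
  moreover have "coins.prob (block k -` E \<inter> space coins) = coins.prob E" if "E \<in> coins.events" for k E
    using measure_distr[OF measurable_block that] distr_block by simp
  ultimately show "coins.prob (block i -` A \<inter> block j -` B) = coins.prob A * coins.prob B"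
    using ij AB by (simp add: space_coins)
qed

section \<open>Coin flips on the unit interval\<close>

text \<open>
  Ternary digits $0$ and $2$ rather than binary digits: the Cantor map is injective on all sequences,
  not merely almost everywhere, and its inverse is a Borel function of the real line.
\<close>

definition cantor :: "(nat \<Rightarrow> bool) \<Rightarrow> real" where
  "cantor \<omega> = (\<Sum>n. 2 * (1/3) ^ Suc n * of_bool (\<omega> n))"

lemma summable_cantor: "summable (\<lambda>n. 2 * (1/3) ^ Suc n * of_bool (\<omega> n) :: real)"
  by (rule summable_comparison_test'[of "\<lambda>n. 2/3 * (1/3) ^ n :: real" 0])
    (auto intro!: summable_mult summable_geometric)

text \<open>
  By these bounds a point of the Cantor set is at most $1/3$ or at least $2/3$, depending on its first
  digit; comparison with $1/2$ therefore reads off that digit.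
\<close>

lemma cantor_bounds: "0 \<le> cantor \<omega>" "cantor \<omega> \<le> 1"
proof -
  show "0 \<le> cantor \<omega>" unfolding cantor_def by (intro suminf_nonneg summable_cantor) simp
  have "cantor \<omega> \<le> (\<Sum>n. 2/3 * (1/3) ^ n)"
    unfolding cantor_def
    by (intro suminf_le summable_cantor summable_mult summable_geometric) auto
  also have "\<dots> = 1"
    using sums_mult[OF geometric_sums[of "1/3 :: real"], of "2/3"] by (simp add: sums_iff)
  finally show "cantor \<omega> \<le> 1" .
qed

lemma cantor_step: "cantor \<omega> = (2 * of_bool (\<omega> 0) + cantor (\<lambda>n. \<omega> (Suc n))) / 3"
proof -
  have "cantor \<omega> = 2/3 * of_bool (\<omega> 0) + (\<Sum>n. 2 * (1/3) ^ Suc (Suc n) * of_bool (\<omega> (Suc n)))"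
    unfolding cantor_def using suminf_split_head[OF summable_cantor, of \<omega>] by simp
  also have "(\<Sum>n. 2 * (1/3) ^ Suc (Suc n) * of_bool (\<omega> (Suc n))) =
      (\<Sum>n. 1/3 * (2 * (1/3) ^ Suc n * of_bool (\<omega> (Suc n))) :: real)"
    by (simp add: mult.assoc)
  also have "\<dots> = 1/3 * cantor (\<lambda>n. \<omega> (Suc n))"
    unfolding cantor_def by (rule suminf_mult[OF summable_cantor])
  finally show ?thesis by simp
qed

definition cantor_shift :: "real \<Rightarrow> real" where
  "cantor_shift x = 3 * x - (if 1/2 \<le> x then 2 else 0)"

definition cantor_digit :: "real \<Rightarrow> nat \<Rightarrow> bool" where
  "cantor_digit x n \<longleftrightarrow> 1/2 \<le> (cantor_shift ^^ n) x"

lemma cantor_ge_half_iff: "1/2 \<le> cantor \<omega> \<longleftrightarrow> \<omega> 0"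
  using cantor_step[of \<omega>] cantor_bounds[of "\<lambda>n. \<omega> (Suc n)"] by (cases "\<omega> 0") auto

lemma cantor_shift_cantor: "cantor_shift (cantor \<omega>) = cantor (\<lambda>n. \<omega> (Suc n))"
  unfolding cantor_shift_def cantor_ge_half_iff using cantor_step[of \<omega>] by (cases "\<omega> 0") auto

lemma cantor_digit_cantor: "cantor_digit (cantor \<omega>) = \<omega>"
proof
  fix n
  have "(cantor_shift ^^ n) (cantor \<omega>) = cantor (\<lambda>m. \<omega> (n + m))"
    by (induction n) (simp_all add: cantor_shift_cantor)
  thus "cantor_digit (cantor \<omega>) n = \<omega> n" by (simp only: cantor_digit_def cantor_ge_half_iff add_0_right)
qed

lemma measurable_cantor: "cantor \<in> borel_measurable coins"
  unfolding cantor_def by (intro borel_measurable_suminf) measurable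

lemma measurable_cantor_digit: "cantor_digit \<in> measurable borel coins"
proof (rule measurable_coinsI)
  fix n
  have [measurable]: "cantor_shift \<in> borel_measurable borel" unfolding cantor_shift_def by measurable
  have [measurable]: "(cantor_shift ^^ n) \<in> borel_measurable borel"
    by (induction n) (auto simp: id_def o_def intro: measurable_compose[of _ borel borel cantor_shift])
  show "(\<lambda>x. cantor_digit x n) \<in> measurable borel (count_space UNIV)"
    unfolding cantor_digit_def by measurable
qed

text \<open>
  The quantile function of \<open>\<nu>\<close>, defined on the open unit interval, has distribution \<open>\<nu>\<close>. It is extended
  by zero, since its formula is an infimum that need not exist at the two endpoints; they form
  a null set.
\<close>

lemma ex_real_random_variable:
  assumes "real_distribution \<nu>"
  shows "\<exists>Y. Y \<in> borel_measurable unit_lebesgue \<and> distr unit_lebesgue borel Y = \<nu>"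
proof -
  interpret cdf_distribution \<nu> by (rule cdf_distribution.intro[OF assms])
  define Y where "Y = (\<lambda>t. if t \<in> {0<..<1} then I t else 0)"
  have Yb: "Y \<in> borel_measurable borel"
    unfolding Y_def using measurable_CI by (subst (asm) measurable_restrict_space_iff) auto
  hence Y: "Y \<in> borel_measurable unit_lebesgue"
    by (intro measurable_restrict_space1 measurable_completion) simp
  have "emeasure (distr unit_lebesgue borel Y) A = emeasure \<nu> A" if A: "A \<in> sets borel" for A
  proof -
    have [measurable]: "Y -` A \<in> sets borel" using measurable_sets[OF Yb A] by simp
    have "emeasure (distr unit_lebesgue borel Y) A = emeasure unit_lebesgue (Y -` A \<inter> {0..1})"
      using A Y by (simp add: emeasure_distr)
    also have "\<dots> = emeasure lborel (Y -` A \<inter> {0..1})"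
      by (subst emeasure_restrict_space) (auto simp: emeasure_completion)
    also have "\<dots> = emeasure lborel (Y -` A \<inter> {0<..<1})"
      using AE_lborel_singleton[of 0] AE_lborel_singleton[of 1]
      by (intro emeasure_eq_AE) (auto elim!: eventually_elim2)
    also have "Y -` A \<inter> {0<..<1} = I -` A \<inter> {0<..<1}" unfolding Y_def by auto
    also have "emeasure lborel \<dots> = emeasure (distr (restrict_space lborel {0<..<1::real}) borel I) A"
      using A by (subst emeasure_distr) (auto simp: space_restrict_space emeasure_restrict_space)
    finally show ?thesis unfolding distr_I_eq_M .
  qed
  thus ?thesis using Y by (intro exI[of _ Y] conjI measure_eqI) auto
qed

lemma ex_coin_flips_on_unit_interval:
  "\<exists>\<psi>. \<psi> \<in> measurable unit_lebesgue coins \<and> distr unit_lebesgue coins \<psi> = coins"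
proof -
  have "real_distribution (distr coins borel cantor)"
    using measurable_cantor by (simp add: real_distribution_def real_distribution_axioms_def coins.prob_space_distr)
  then obtain Y where Y: "Y \<in> borel_measurable unit_lebesgue"
    "distr unit_lebesgue borel Y = distr coins borel cantor"
    using ex_real_random_variable by blast
  have "distr unit_lebesgue coins (cantor_digit \<circ> Y) = distr (distr coins borel cantor) coins cantor_digit"
    unfolding Y(2)[symmetric] by (rule distr_distr[symmetric, OF measurable_cantor_digit Y(1)])
  also have "\<dots> = coins"
    by (subst distr_distr[OF measurable_cantor_digit measurable_cantor])
      (simp add: o_def cantor_digit_cantor)
  finally show ?thesis using measurable_comp[OF Y(1) measurable_cantor_digit] by blast
qed

section \<open>Indicator functions in \<open>L\<^sub>1\<close>\<close>

lemma norm_abs_L1_diff: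
  assumes f: "integrable unit_lebesgue f" and g: "integrable unit_lebesgue g"
  shows "norm (abs_L1 f - abs_L1 g) = (LINT t|unit_lebesgue. \<bar>f t - g t\<bar>)"
proof -
  have "L1_rel f f" "L1_rel g g" "L1_rel (\<lambda>t. f t - g t) (\<lambda>t. f t - g t)"
    using assms by (auto simp: L1_rel_def)
  thus ?thesis by (simp add: minus_L1.abs_eq norm_L1.abs_eq)
qed

lemma norm_indicator_L1_diff:
  assumes [measurable]: "A \<in> sets unit_lebesgue" "B \<in> sets unit_lebesgue"
  shows "norm (abs_L1 (indicator A) - abs_L1 (indicator B)) = measure unit_lebesgue (sym_diff A B)"
proof -
  have fin: "emeasure unit_lebesgue X < \<infinity>" if "X \<in> sets unit_lebesgue" for X
  proof -
    have "emeasure unit_lebesgue X \<le> emeasure unit_lebesgue (space unit_lebesgue)"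
      by (rule emeasure_space)
    also have "\<dots> < \<infinity>" by (simp add: emeasure_restrict_space)
    finally show ?thesis .
  qed
  have "norm (abs_L1 (indicator A) - abs_L1 (indicator B)) =
      (LINT t|unit_lebesgue. \<bar>indicator A t - indicator B t\<bar>)"
    using fin assms by (intro norm_abs_L1_diff) (auto intro!: integrable_real_indicator)
  also have "\<dots> = (LINT t|unit_lebesgue. indicator (sym_diff A B) t)"
    by (intro Bochner_Integration.integral_cong) (auto simp: indicator_def)
  also have "\<dots> = measure unit_lebesgue (sym_diff A B)"
  proof -
    have "sym_diff A B \<inter> {0..1} = sym_diff A B"
      using sets.sets_into_space[OF assms(1)] sets.sets_into_space[OF assms(2)] by auto
    thus ?thesis by simp
  qed
  finally show ?thesis .
qed

theorem corollary7p7: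
  fixes enum :: "countable_ordinal \<Rightarrow> nat \<Rightarrow> countable_ordinal" and \<alpha> :: countable_ordinal
  assumes "ordinal_enumeration enum" and "0 < \<alpha>"
  shows "\<exists>\<Psi> :: point \<Rightarrow> L1.
    \<forall>x \<in> ordinal_enumeration.diamond_points enum \<alpha>. \<forall>y \<in> ordinal_enumeration.diamond_points enum \<alpha>.
      1/2 * ordinal_enumeration.diamond_dist enum \<alpha> x y \<le> norm (\<Psi> x - \<Psi> y) \<and>
      norm (\<Psi> x - \<Psi> y) \<le> ordinal_enumeration.diamond_dist enum \<alpha> x y"
proof -
  interpret ordinal_enumeration enum by (rule assms(1))
  obtain S where S: "coins.cut_embedding (diamond \<alpha>) S"
    using coins.ex_cut_embedding_diamond[OF assms(1)] by blast
  obtain \<psi> where \<psi>: "\<psi> \<in> measurable unit_lebesgue coins" "distr unit_lebesgue coins \<psi> = coins"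
    using ex_coin_flips_on_unit_interval by blast
  define T where "T x = \<psi> -` S x \<inter> {0..1}" for x
  have norm_eq: "norm (abs_L1 (indicator (T x)) - abs_L1 (indicator (T y))) =
      coins.prob (sym_diff (S x) (S y))"
    if "x \<in> diamond_points \<alpha>" "y \<in> diamond_points \<alpha>" for x y
  proof -
    have ev: "S x \<in> coins.events" "S y \<in> coins.events"
      using coins.cut_embeddingD(5)[OF S] that by (auto simp: diamond_points_def)
    have "T x \<in> sets unit_lebesgue" "T y \<in> sets unit_lebesgue"
      using measurable_sets[OF \<psi>(1)] ev unfolding T_def by fastforce+
    hence "norm (abs_L1 (indicator (T x)) - abs_L1 (indicator (T y))) =
        measure unit_lebesgue (sym_diff (T x) (T y))" by (rule norm_indicator_L1_diff)
    also have "sym_diff (T x) (T y) = \<psi> -` sym_diff (S x) (S y) \<inter> space unit_lebesgue"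
      unfolding T_def by auto
    also have "measure unit_lebesgue \<dots> = measure (distr unit_lebesgue coins \<psi>) (sym_diff (S x) (S y))"
      using ev by (intro measure_distr[symmetric] \<psi>) auto
    finally show ?thesis by (simp add: \<psi>(2))
  qed
  show ?thesis
  proof (intro exI ballI)
    fix x y assume xy: "x \<in> diamond_points \<alpha>" "y \<in> diamond_points \<alpha>"
    let ?\<Psi> = "\<lambda>x. abs_L1 (indicator (T x))"
    show "1/2 * diamond_dist \<alpha> x y \<le> norm (?\<Psi> x - ?\<Psi> y) \<and> norm (?\<Psi> x - ?\<Psi> y) \<le> diamond_dist \<alpha> x y"
      using coins.cut_embeddingD(9,10)[OF S, of x y] xy
      by (simp add: norm_eq[OF xy] diamond_points_def diamond_dist_def)
  qed
qed

end
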